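(* Let $\mathcal{H}$ be a complex Hilbert space and let $T\in\mathcal{B}(\mathcal{H})$ be subnormal. Assume that $T^2$ is quasinormal. If $T$ is bounded below (i.e., left invertible), then $T$ is quasinormal.
   Context: $\mathcal{B}(\mathcal{H})$ is the algebra of bounded linear operators on $\mathcal{H}$. An operator $T$ is subnormal if there are a Hilbert space $\mathcal{K}\supseteq\mathcal{H}$ and a normal operator $N\in\mathcal{B}(\mathcal{K})$ with $N(\mathcal{H})\subseteq\mathcal{H}$ and $T=N|_{\mathcal{H}}$. An operator $T$ is quasinormal if it commutes with $T^*T$. *)

theory Defs
  imports "HOL-Analysis.Analysis"
begin

class complex_vector = real_vector +
  fixes scaleC :: "complex \<Rightarrow> 'a \<Rightarrow> 'a" (infixr "*\<^sub>C" 75)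
  assumes scaleC_add_right: "c *\<^sub>C (x + y) = c *\<^sub>C x + c *\<^sub>C y"
    and scaleC_add_left: "(c + d) *\<^sub>C x = c *\<^sub>C x + d *\<^sub>C x"
    and scaleC_scaleC: "c *\<^sub>C (d *\<^sub>C x) = (c * d) *\<^sub>C x"
    and scaleC_one: "1 *\<^sub>C x = x"
    and scaleR_scaleC: "r *\<^sub>R x = complex_of_real r *\<^sub>C x"

text \<open>The inner product is linear in its first argument. Completeness and the norm topology
  come from \<^class>\<open>banach\<close>; the last axiom ties that norm to the inner product.\<close>

class complex_hilbert = complex_vector + banach +
  fixes cinner :: "'a \<Rightarrow> 'a \<Rightarrow> complex"
  assumes cinner_commute: "cinner x y = cnj (cinner y x)"
    and cinner_add_left: "cinner (x + y) z = cinner x z + cinner y z"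
    and cinner_scaleC_left: "cinner (c *\<^sub>C x) y = c * cinner x y"
    and cinner_self: "cinner x x = complex_of_real ((norm x)\<^sup>2)"

instantiation complex :: complex_hilbert
begin

definition scaleC_complex :: "complex \<Rightarrow> complex \<Rightarrow> complex"
  where "scaleC_complex c x = c * x"

definition cinner_complex :: "complex \<Rightarrow> complex \<Rightarrow> complex"
  where "cinner_complex x y = x * cnj y"

instance
  by standard
    (simp_all add: scaleC_complex_def cinner_complex_def algebra_simps scaleR_conv_of_real
      flip: complex_norm_square)

end

definition bounded_clinear :: "('a::complex_hilbert \<Rightarrow> 'b::complex_hilbert) \<Rightarrow> bool"
  where "bounded_clinear T \<longleftrightarrow> bounded_linear T \<and> (\<forall>c x. T (c *\<^sub>C x) = c *\<^sub>C T x)"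

text \<open>For bounded operators the adjoint exists, by the Riesz representation theorem, and is
  unique. The choice operator is used as in \<^const>\<open>adjoint\<close>, the adjoint for real inner
  product spaces.\<close>

definition cadjoint :: "('a::complex_hilbert \<Rightarrow> 'b::complex_hilbert) \<Rightarrow> 'b \<Rightarrow> 'a"
  where "cadjoint T = (SOME S. \<forall>x y. cinner (T x) y = cinner x (S y))"

definition normal_op :: "('a::complex_hilbert \<Rightarrow> 'a) \<Rightarrow> bool"
  where "normal_op N \<longleftrightarrow> cadjoint N \<circ> N = N \<circ> cadjoint N"

definition quasinormal_op :: "('a::complex_hilbert \<Rightarrow> 'a) \<Rightarrow> bool"
  where "quasinormal_op T \<longleftrightarrow> T \<circ> (cadjoint T \<circ> T) = (cadjoint T \<circ> T) \<circ> T"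

text \<open>The space \<open>K\<close> containing \<open>H\<close> is the type \<open>'k\<close>, with \<open>H\<close> embedded by the
  linear isometry \<open>V\<close>; the equation \<open>N (V x) = V (T x)\<close> says both that \<open>N\<close> leaves
  the copy of \<open>H\<close> invariant and that it restricts there to \<open>T\<close>. HOL cannot quantify over
  types inside a definition, so \<open>'k\<close> is a parameter: as a hypothesis of a theorem in which
  \<open>'k\<close> is an otherwise unconstrained type variable, this expresses
  that some space \<open>K\<close> exists.\<close>

definition subnormal_op :: "'k::complex_hilbert itself \<Rightarrow> ('h::complex_hilbert \<Rightarrow> 'h) \<Rightarrow> bool"
  where "subnormal_op K T \<longleftrightarrow>
    (\<exists>(V :: 'h \<Rightarrow> 'k) (N :: 'k \<Rightarrow> 'k).
      bounded_clinear V \<and> (\<forall>x y. cinner (V x) (V y) = cinner x y) \<and>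
      bounded_clinear N \<and> normal_op N \<and>
      (\<forall>x. N (V x) = V (T x)))"

definition bounded_below :: "('a::complex_hilbert \<Rightarrow> 'b::complex_hilbert) \<Rightarrow> bool"
  where "bounded_below T \<longleftrightarrow> (\<exists>c>0. \<forall>x. c * norm x \<le> norm (T x))"

end

theory Submission
  imports Defs
begin

text \<open>Let \<open>N\<close> be a normal extension of \<open>T\<close> to \<open>K\<close>, let \<open>P\<close> be the projection of \<open>K\<close> onto
  \<open>H\<close>, and put \<open>A = N\<^sup>* N\<close>. The operator \<open>(T\<^sup>2)\<^sup>* T\<^sup>2\<close> is the compression of \<open>A\<^sup>2\<close> to \<open>H\<close>, and quasinormality
  of \<open>T\<^sup>2\<close> makes its square the compression of \<open>A\<^sup>4\<close>. Hence compressing \<open>A\<^sup>2\<close> loses no norm, so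
  \<open>A\<^sup>2\<close> maps \<open>H\<close> into itself and commutes with \<open>P\<close>. Since \<open>A\<close> is the positive square root of
  \<open>A\<^sup>2\<close>, it leaves \<open>H\<close> invariant as well: the commutator \<open>P A - A P\<close> anticommutes
  with \<open>A\<close>, and for positive \<open>A\<close> such an operator is annihilated by \<open>A\<close>. Therefore \<open>T\<^sup>* T\<close> is
  the restriction of \<open>A\<close> to \<open>H\<close>, and it commutes with \<open>T\<close> because \<open>A\<close> commutes with \<open>N\<close>.\<close>

section \<open>Inner products and adjoints\<close>

lemma cinner_add_right: "cinner x (y + z) = cinner x y + cinner (x::'a::complex_hilbert) z"
  by (metis cinner_add_left cinner_commute complex_cnj_add)

lemma cinner_zero_left [simp]: "cinner 0 (x::'a::complex_hilbert) = 0"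
  using cinner_add_left[of 0 0 x] by simp

lemma cinner_zero_right [simp]: "cinner (x::'a::complex_hilbert) 0 = 0"
  using cinner_add_right[of x 0 0] by simp

lemma cinner_minus_left [simp]: "cinner (- x) y = - cinner (x::'a::complex_hilbert) y"
  using cinner_add_left[of x "- x" y] by (simp add: eq_neg_iff_add_eq_0 add.commute)

lemma cinner_minus_right [simp]: "cinner x (- y) = - cinner (x::'a::complex_hilbert) y"
  using cinner_add_right[of x y "- y"] by (simp add: eq_neg_iff_add_eq_0 add.commute)

lemma cinner_diff_left: "cinner (x - y) z = cinner x z - cinner (y::'a::complex_hilbert) z"
  using cinner_add_left[of x "- y" z] by simp

lemma cinner_diff_right: "cinner x (y - z) = cinner x y - cinner (x::'a::complex_hilbert) z"
  using cinner_add_right[of x y "- z"] by simp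

lemma cinner_scaleC_right: "cinner x (c *\<^sub>C y) = cnj c * cinner (x::'a::complex_hilbert) y"
  by (metis cinner_commute cinner_scaleC_left complex_cnj_mult)

lemma cinner_scaleR_left: "cinner (r *\<^sub>R x) y = of_real r * cinner (x::'a::complex_hilbert) y"
  by (simp add: scaleR_scaleC cinner_scaleC_left)

lemma cinner_scaleR_right: "cinner x (r *\<^sub>R y) = of_real r * cinner (x::'a::complex_hilbert) y"
  by (simp add: scaleR_scaleC cinner_scaleC_right)

lemmas cinner_simps = cinner_add_left cinner_add_right cinner_diff_left cinner_diff_right
  cinner_scaleR_left cinner_scaleR_right

lemma Re_cinner_self: "Re (cinner x x) = (norm (x::'a::complex_hilbert))\<^sup>2"
  by (simp add: cinner_self)

lemma Re_cinner_commute: "Re (cinner x y) = Re (cinner y (x::'a::complex_hilbert))"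
  by (metis cinner_commute cnj.sel(1))

lemma norm_add_cinner:
  "(norm (x + y))\<^sup>2 = (norm x)\<^sup>2 + 2 * Re (cinner x y) + (norm (y::'a::complex_hilbert))\<^sup>2"
  using Re_cinner_commute[of x y] by (simp add: cinner_simps flip: Re_cinner_self)

lemma norm_diff_cinner:
  "(norm (x - y))\<^sup>2 = (norm x)\<^sup>2 - 2 * Re (cinner x y) + (norm (y::'a::complex_hilbert))\<^sup>2"
  using norm_add_cinner[of x "- y"] by simp

lemma Re_cinner_le: "Re (cinner x y) \<le> norm x * norm (y::'a::complex_hilbert)"
proof -
  have "(norm (x + y))\<^sup>2 \<le> (norm x + norm y)\<^sup>2"
    by (simp add: norm_triangle_ineq power_mono)
  then show ?thesis
    by (simp add: norm_add_cinner power2_sum)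
qed

lemma cinner_eqI:
  fixes x y :: "'a::complex_hilbert"
  assumes "\<And>z. cinner x z = cinner y z"
  shows "x = y"
proof -
  have "Re (cinner (x - y) (x - y)) = 0"
    using assms[of "x - y"] by (simp add: cinner_diff_left)
  then show ?thesis
    by (simp add: Re_cinner_self)
qed

text \<open>Riesz representation: the representing vector minimises \<open>(norm x)\<^sup>2 - 2 * f x\<close>,
  and the parallelogram law makes minimising sequences Cauchy.\<close>

lemma riesz_real:
  fixes f :: "'a::complex_hilbert \<Rightarrow> real"
  assumes "bounded_linear f"
  obtains z where "\<And>x. f x = Re (cinner x z)"
proof -
  interpret f: bounded_linear f by fact
  define J where "J x = (norm x)\<^sup>2 - 2 * f x" for x
  obtain K where K: "\<And>x. norm (f x) \<le> norm x * K"
    using f.bounded by blast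
  \<comment> \<open>Complete the square in \<open>norm x\<close>, using
    \<open>f x \<le> norm x * K\<close>.\<close>
  have "- K\<^sup>2 \<le> J x" for x
  proof -
    have "0 \<le> (norm x - K)\<^sup>2" by simp
    then show ?thesis
      using K[of x] unfolding J_def power2_diff by (simp add: algebra_simps)
  qed
  then have bdd: "bdd_below (range J)"
    by (auto intro!: bdd_belowI)
  define m where "m = Inf (range J)"
  have m_le: "m \<le> J x" for x
    unfolding m_def by (rule cInf_lower) (use bdd in auto)
  define r where "r n = inverse (real (Suc n))" for n :: nat
  have "\<exists>x. J x < m + r n" for n
    using cInf_lessD[of "range J" "m + r n"] by (auto simp: m_def r_def)
  then obtain X where X: "\<And>n. J (X n) < m + r n"
    by metis
  have parallelogram: "(norm (x - y))\<^sup>2 = 2 * J x + 2 * J y - 4 * J ((1/2) *\<^sub>R (x + y))" for x y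
  proof -
    have "4 * J ((1/2) *\<^sub>R (x + y)) = (norm (x + y))\<^sup>2 - 4 * (f x + f y)"
      by (simp only: J_def f.scaleR f.add norm_scaleR power_mult_distrib)
        (simp add: power2_eq_square field_simps)
    then show ?thesis
      using norm_add_cinner[of x y] norm_diff_cinner[of x y] by (simp add: J_def)
  qed
  \<comment> \<open>The midpoint of \<open>x\<close> and \<open>X n\<close> has value at least
    \<open>m\<close>.\<close>
  have dist_X: "(norm (x - X n))\<^sup>2 \<le> 2 * (J x - m) + 2 * r n" for x n
    using parallelogram[of x "X n"] m_le[of "(1/2) *\<^sub>R (x + X n)"] X[of n] by simp
  have "Cauchy X"
  proof (rule CauchyI)
    fix e :: real assume "0 < e"
    then obtain M where M: "r M < e\<^sup>2 / 4"
      using reals_Archimedean[of "e\<^sup>2 / 4"] by (auto simp: r_def)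
    have "norm (X i - X n) < e" if "M \<le> i" "M \<le> n" for i n
    proof -
      have "r i \<le> r M" "r n \<le> r M"
        using that by (simp_all add: r_def field_simps)
      then have "2 * (J (X i) - m) + 2 * r n < 4 * r M"
        using X[of i] by argo
      then have "(norm (X i - X n))\<^sup>2 < e\<^sup>2"
        using dist_X[of "X i" n] M by simp
      then show ?thesis
        using \<open>0 < e\<close> by (simp add: power_less_imp_less_base)
    qed
    then show "\<exists>M. \<forall>i\<ge>M. \<forall>n\<ge>M. norm (X i - X n) < e"
      by blast
  qed
  then obtain z where z: "X \<longlonglongrightarrow> z"
    using Cauchy_convergent convergentD by blast
  have "(\<lambda>n. J (X n)) \<longlonglongrightarrow> J z"
    unfolding J_def by (intro tendsto_intros z f.tendsto)
  moreover have "(\<lambda>n. m + r n) \<longlonglongrightarrow> m + 0"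
    unfolding r_def by (intro tendsto_intros LIMSEQ_inverse_real_of_nat)
  ultimately have "J z \<le> m + 0"
    by (rule LIMSEQ_le) (use X less_imp_le in blast)
  then have J_z: "J z \<le> J x" for x
    using m_le[of x] by simp
  have "f h = Re (cinner h z)" for h
  proof -
    define d where "d = f h - Re (cinner h z)"
    \<comment> \<open>If \<open>d\<close> were nonzero, moving from \<open>z\<close> by
      \<open>s\<close> along \<open>h\<close> would push \<open>J\<close> below its minimum. The
      summand 1 keeps the denominator positive at \<open>h = 0\<close>.\<close>
    define s where "s = d / (1 + (norm h)\<^sup>2)"
    have pos: "0 < 1 + (norm h)\<^sup>2"
      by (simp add: add_pos_nonneg)
    have "J (z + s *\<^sub>R h) = J z - 2 * s * d + s\<^sup>2 * (norm h)\<^sup>2"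
      unfolding J_def d_def f.add f.scaleR norm_add_cinner
      by (simp add: cinner_simps Re_cinner_commute[of z h] power_mult_distrib algebra_simps)
    then have "2 * s * d \<le> s\<^sup>2 * (norm h)\<^sup>2"
      using J_z[of "z + s *\<^sub>R h"] by simp
    moreover have "d = s * (1 + (norm h)\<^sup>2)"
      using pos by (simp add: s_def)
    ultimately have "2 * s\<^sup>2 + s\<^sup>2 * (norm h)\<^sup>2 \<le> 0"
      by (simp add: power2_eq_square algebra_simps)
    then have "s\<^sup>2 \<le> 0"
      using mult_nonneg_nonneg[of "s\<^sup>2" "(norm h)\<^sup>2"] by (smt (verit) zero_le_power2)
    then have "d = 0"
      using \<open>d = s * (1 + (norm h)\<^sup>2)\<close> by simp
    then show ?thesis
      by (simp add: d_def)
  qed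
  then show thesis
    by (rule that)
qed

lemma bounded_linear_Re_cinner_left:
  "bounded_linear (\<lambda>x. Re (cinner x (y::'a::complex_hilbert)))"
proof (rule bounded_linear_intro)
  show "norm (Re (cinner x y)) \<le> norm x * norm y" for x
    using Re_cinner_le[of x y] Re_cinner_le[of "- x" y] by simp
qed (simp_all add: cinner_simps)

lemma cadjoint_exists:
  fixes T :: "'a::complex_hilbert \<Rightarrow> 'b::complex_hilbert"
  assumes "bounded_clinear T"
  shows "\<exists>S. \<forall>x y. cinner (T x) y = cinner x (S y)"
proof -
  have T: "bounded_linear T" and scale: "\<And>c x. T (c *\<^sub>C x) = c *\<^sub>C T x"
    using assms by (auto simp: bounded_clinear_def)
  have "\<exists>z. \<forall>x. cinner (T x) y = cinner x z" for y
  proof -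
    obtain z where z: "\<And>x. Re (cinner (T x) y) = Re (cinner x z)"
      using riesz_real[OF bounded_linear_compose[OF bounded_linear_Re_cinner_left T]] by metis
    \<comment> \<open>Multiplication by \<i> turns real parts into negated imaginary parts.\<close>
    have "Im (cinner (T x) y) = Im (cinner x z)" for x
      using z[of "\<i> *\<^sub>C x"] by (simp add: scale cinner_scaleC_left)
    then show ?thesis
      using z by (auto simp: complex_eq_iff)
  qed
  then show ?thesis
    by metis
qed

lemma cinner_cadjoint_right:
  assumes "bounded_clinear T"
  shows "cinner x (cadjoint T y) = cinner (T x) y"
  using someI_ex[OF cadjoint_exists[OF assms], folded cadjoint_def] by metis

lemma cinner_cadjoint_left:
  assumes "bounded_clinear T"
  shows "cinner (cadjoint T y) x = cinner y (T x)"
  using cinner_cadjoint_right[OF assms, of x y]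
  by (simp add: cinner_commute[of "cadjoint T y"] cinner_commute[of y])

lemma bounded_linear_cadjoint:
  assumes "bounded_clinear T"
  shows "bounded_linear (cadjoint T)"
proof -
  note adj = cinner_cadjoint_left[OF assms]
  interpret T: bounded_linear T
    using assms by (simp add: bounded_clinear_def)
  obtain K where K: "0 \<le> K" "\<And>x. norm (T x) \<le> norm x * K"
    using T.nonneg_bounded by blast
  show ?thesis
  proof (rule bounded_linear_intro)
    show "cadjoint T (x + y) = cadjoint T x + cadjoint T y" for x y
      by (rule cinner_eqI) (simp add: adj cinner_simps)
    show "cadjoint T (r *\<^sub>R x) = r *\<^sub>R cadjoint T x" for r x
      by (rule cinner_eqI) (simp add: adj cinner_simps)
    show "norm (cadjoint T y) \<le> norm y * K" for y
    proof -
      have "norm (cadjoint T y) * norm (cadjoint T y) = Re (cinner y (T (cadjoint T y)))"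
        by (metis Re_cinner_self adj power2_eq_square)
      also have "\<dots> \<le> norm y * norm (T (cadjoint T y))"
        by (rule Re_cinner_le)
      also have "\<dots> \<le> (norm y * K) * norm (cadjoint T y)"
        using mult_left_mono[OF K(2), of "norm y" "cadjoint T y"] by (simp add: ac_simps)
      finally show ?thesis
        using K(1) by (cases "cadjoint T y = 0") auto
    qed
  qed
qed

lemma bounded_clinear_compose:
  assumes "bounded_clinear f" and "bounded_clinear g"
  shows "bounded_clinear (f \<circ> g)"
proof -
  have "bounded_linear (f \<circ> g)"
    using assms bounded_linear_compose[of f g] unfolding bounded_clinear_def o_def by blast
  then show ?thesis
    using assms unfolding bounded_clinear_def by simp
qed

section \<open>Operators anticommuting with a positive operator\<close>

locale positive_operator =
  fixes A :: "'a::complex_hilbert \<Rightarrow> 'a"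
  assumes bounded: "bounded_linear A"
    and selfadjoint: "cinner (A x) y = cinner x (A y)"
    and pos: "0 \<le> Re (cinner (A x) x)"
begin

sublocale bounded_linear A
  by (fact bounded)

text \<open>Expand positivity of \<open>A\<close> at \<open>x - s *\<^sub>R A x\<close> with
  \<open>s = 1 / K\<close>, where \<open>K\<close> bounds \<open>A\<close>. In operator form the
  result is A^2 \<le> t A.\<close>

lemma norm_square_le:
  obtains t where "0 < t" and "\<And>x. (norm (A x))\<^sup>2 \<le> t * Re (cinner (A x) x)"
proof -
  obtain K where K: "0 < K" "\<And>x. norm (A x) \<le> norm x * K"
    using pos_bounded by blast
  have "(norm (A x))\<^sup>2 \<le> K * Re (cinner (A x) x)" for x
  proof -
    define s where "s = 1 / K"
    have "Re (cinner (A (x - s *\<^sub>R A x)) (x - s *\<^sub>R A x)) =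
        Re (cinner (A x) x) - 2 * s * (norm (A x))\<^sup>2 + s\<^sup>2 * Re (cinner (A (A x)) (A x))"
      by (simp add: diff scaleR cinner_simps selfadjoint[of "A x" x] Re_cinner_self
          power2_eq_square[of s] algebra_simps)
    moreover have "s\<^sup>2 * Re (cinner (A (A x)) (A x)) \<le> s * (norm (A x))\<^sup>2"
    proof -
      have "Re (cinner (A (A x)) (A x)) \<le> norm (A (A x)) * norm (A x)"
        by (rule Re_cinner_le)
      also have "\<dots> \<le> K * (norm (A x))\<^sup>2"
        using mult_right_mono[OF K(2), of "norm (A x)" "A x"] by (simp add: power2_eq_square ac_simps)
      finally show ?thesis
        using K(1) by (simp add: s_def power2_eq_square field_simps)
    qed
    ultimately have "s * (norm (A x))\<^sup>2 \<le> Re (cinner (A x) x)"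
      using pos[of "x - s *\<^sub>R A x"] by simp
    then show ?thesis
      using K(1) by (simp add: s_def field_simps)
  qed
  with K(1) show thesis
    by (rule that)
qed

text \<open>If \<open>S\<close> anticommutes with \<open>A\<close>, then \<open>(t + A)\<^sup>n S = S (t - A)\<^sup>n\<close>. For large \<open>t\<close>,
  the right-hand side is \<open>O(t\<^sup>n)\<close>, whereas the left-hand side grows faster by a factor
  of order \<open>sqrt n\<close> on vectors with \<open>A (S x) \<noteq> 0\<close>.\<close>

lemma anticommute_imp_zero:
  assumes S: "bounded_linear S" and anti: "\<And>x. A (S x) = - S (A x)"
  shows "A (S x) = 0"
proof -
  interpret S: bounded_linear S by fact
  obtain t where t: "0 < t" "\<And>x. (norm (A x))\<^sup>2 \<le> t * Re (cinner (A x) x)"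
    using norm_square_le by blast
  obtain C where C: "0 \<le> C" "\<And>x. norm (S x) \<le> norm x * C"
    using S.nonneg_bounded by blast
  define F where "F y = t *\<^sub>R y + A y" for y
  define G where "G y = t *\<^sub>R y - A y" for y
  define q where "q y = Re (cinner (A y) y)" for y
  have "F (S y) = S (G y)" for y
    by (simp add: F_def G_def S.diff S.scaleR anti)
  then have intertwine: "(F ^^ n) (S y) = S ((G ^^ n) y)" for n y
    by (induction n) auto
  \<comment> \<open>The cross term \<open>- 2 * t * q y\<close> absorbs
    \<open>(norm (A y))\<^sup>2\<close>, which is at most \<open>t * q y\<close>.\<close>
  have contract: "norm (G y) \<le> t * norm y" for y
  proof (rule power2_le_imp_le)
    show "(norm (G y))\<^sup>2 \<le> (t * norm y)\<^sup>2"
      using t(2)[of y] mult_nonneg_nonneg[OF less_imp_le[OF t(1)] pos[of y]]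
      by (simp add: G_def norm_diff_cinner cinner_simps Re_cinner_commute[of y "A y"] power_mult_distrib)
  qed (use t(1) in simp)
  have upper: "norm ((G ^^ n) y) \<le> t ^ n * norm y" for n y
  proof (induction n)
    case (Suc n)
    have "norm ((G ^^ Suc n) y) \<le> t * norm ((G ^^ n) y)"
      using contract by simp
    also have "\<dots> \<le> t * (t ^ n * norm y)"
      using Suc t(1) by simp
    finally show ?case by (simp add: ac_simps)
  qed simp
  have q_F: "t\<^sup>2 * q y \<le> q (F y)" for y
    using t(1) pos[of "A y"]
    by (simp add: q_def F_def add scaleR cinner_simps Re_cinner_self selfadjoint[of "A y" y]
        power2_eq_square algebra_simps)
  have q_F_pow: "t ^ (2 * n) * q y \<le> q ((F ^^ n) y)" for n y
  proof (induction n)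
    case (Suc n)
    have "t ^ (2 * Suc n) * q y = t\<^sup>2 * (t ^ (2 * n) * q y)"
      by (simp add: power2_eq_square)
    also have "\<dots> \<le> t\<^sup>2 * q ((F ^^ n) y)"
      using Suc t(1) by simp
    also have "\<dots> \<le> q ((F ^^ Suc n) y)"
      using q_F by simp
    finally show ?case .
  qed simp
  have norm_F: "t\<^sup>2 * (norm y)\<^sup>2 + 2 * t * q y \<le> (norm (F y))\<^sup>2" for y
    by (simp add: F_def q_def norm_add_cinner cinner_simps Re_cinner_commute[of y "A y"] power_mult_distrib)
  \<comment> \<open>Relative to \<open>t ^ (2 * n)\<close>, each application of \<open>F\<close>
    adds at least \<open>2 * q y / t\<close> to the squared norm. The factor \<open>t\<close> on the
    right avoids the exponent \<open>2 * n - 1\<close>.\<close>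
  have lower: "t ^ (2 * n) * (2 * real n * q y) \<le> t * (norm ((F ^^ n) y))\<^sup>2" for n y
  proof (induction n)
    case (Suc n)
    have "t ^ (2 * Suc n) * (2 * real (Suc n) * q y) =
        t\<^sup>2 * (t ^ (2 * n) * (2 * real n * q y)) + 2 * t\<^sup>2 * (t ^ (2 * n) * q y)"
      by (simp add: power2_eq_square algebra_simps)
    also have "\<dots> \<le> t\<^sup>2 * (t * (norm ((F ^^ n) y))\<^sup>2) + 2 * t\<^sup>2 * q ((F ^^ n) y)"
      by (intro add_mono mult_left_mono Suc q_F_pow) simp_all
    also have "\<dots> = t * (t\<^sup>2 * (norm ((F ^^ n) y))\<^sup>2 + 2 * t * q ((F ^^ n) y))"
      by (simp add: power2_eq_square algebra_simps)
    also have "\<dots> \<le> t * (norm ((F ^^ Suc n) y))\<^sup>2"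
      using norm_F[of "(F ^^ n) y"] t(1) by simp
    finally show ?case .
  qed (use t(1) in simp)
  have "real n * (2 * q (S x)) \<le> t * (norm x * C)\<^sup>2" for n
  proof -
    have "norm ((F ^^ n) (S x)) \<le> t ^ n * norm x * C"
      using C(2)[of "(G ^^ n) x"] mult_right_mono[OF upper[of n x] C(1)]
      unfolding intertwine by (rule order_trans)
    then have "(norm ((F ^^ n) (S x)))\<^sup>2 \<le> (t ^ n * norm x * C)\<^sup>2"
      by (simp add: power_mono)
    then have "t ^ (2 * n) * (2 * real n * q (S x)) \<le> t * (t ^ n * norm x * C)\<^sup>2"
      by (intro order_trans[OF lower] mult_left_mono) (use t(1) in auto)
    also have "\<dots> = t ^ (2 * n) * (t * (norm x * C)\<^sup>2)"
      by (simp add: power_mult_distrib power_mult power2_eq_square)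
    finally show ?thesis
      using t(1) by (simp add: ac_simps)
  qed
  then have "2 * q (S x) \<le> 0"
    using reals_Archimedean3[of "2 * q (S x)"] by (meson not_le)
  then have "(norm (A (S x)))\<^sup>2 \<le> 0"
    by (intro order_trans[OF t(2)] mult_nonneg_nonpos) (use t(1) in \<open>auto simp: q_def\<close>)
  then show ?thesis by simp
qed

end

section \<open>Subnormal square roots of quasinormal operators\<close>

theorem theorem2p3:
  fixes T :: "'h::complex_hilbert \<Rightarrow> 'h"
  assumes "bounded_clinear T"
    and "subnormal_op TYPE('k::complex_hilbert) T"
    and "quasinormal_op (T ^^ 2)"
    and "bounded_below T"
  shows "quasinormal_op T"
proof -
  obtain V :: "'h \<Rightarrow> 'k" and N :: "'k \<Rightarrow> 'k"
    where V: "bounded_clinear V" and iso: "\<And>x y. cinner (V x) (V y) = cinner x y"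
      and N: "bounded_clinear N" and normal: "normal_op N" and NV: "\<And>x. N (V x) = V (T x)"
    using assms(2) unfolding subnormal_op_def by blast
  define W where "W = cadjoint V"
  define A where "A = cadjoint N \<circ> N"
  define P where "P = V \<circ> W"
  define U where "U = T ^^ 2"
  define B where "B = cadjoint U \<circ> U"
  have lin: "bounded_linear V" "bounded_linear N" "bounded_linear W" "bounded_linear (cadjoint N)"
    using V N bounded_linear_cadjoint unfolding bounded_clinear_def W_def by auto
  have U: "bounded_clinear U"
    using bounded_clinear_compose[OF assms(1) assms(1)] by (simp add: U_def numeral_2_eq_2)
  note adj_T = cinner_cadjoint_left[OF assms(1)] cinner_cadjoint_right[OF assms(1)]
  note adj_U = cinner_cadjoint_left[OF U] cinner_cadjoint_right[OF U]
  note adj_N = cinner_cadjoint_left[OF N] cinner_cadjoint_right[OF N]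
  note adj_V = cinner_cadjoint_left[OF V, folded W_def] cinner_cadjoint_right[OF V, folded W_def]
  have A_bounded: "bounded_linear A"
    using bounded_linear_compose[OF lin(4,2)] by (simp add: A_def o_def)
  interpret A: positive_operator A
    by (rule positive_operator.intro[OF A_bounded]) (simp_all add: A_def adj_N Re_cinner_self)
  interpret W: bounded_linear W
    by (rule lin(3))
  have V_inj: "x = y" if "V x = V y" for x y
    by (rule cinner_eqI) (metis iso that)
  have AN: "A (N x) = N (A x)" for x
    using normal unfolding normal_op_def A_def o_def by metis
  have WV: "W (V x) = x" for x
    by (rule cinner_eqI) (simp add: adj_V iso)
  have VU: "V (U x) = N (N (V x))" for x
    by (simp add: NV U_def numeral_2_eq_2)
  have UB: "U (B x) = B (U x)" for x
    using assms(3) unfolding quasinormal_op_def B_def U_def[symmetric] o_def by metis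
  have B_sym: "cinner (B x) y = cinner x (B y)" for x y
    by (simp add: B_def adj_U)
  have cinner_A: "cinner (A x) y = cinner (N x) (N y)" for x y
    by (simp add: A_def adj_N)
  have WA: "W (A (V x)) = cadjoint T (T x)" for x
    by (rule cinner_eqI) (simp add: adj_V adj_T cinner_A NV iso)
  \<comment> \<open>Normality enters here: as \<open>A\<close> commutes with \<open>N\<close>, the
    square of \<open>A\<close> is the adjoint of N^2 times N^2.\<close>
  have WA2: "W (A (A (V x))) = B x" for x
  proof (rule cinner_eqI)
    fix y
    have "cinner (W (A (A (V x)))) y = cinner (N (N (V x))) (N (N (V y)))"
      by (simp only: adj_V cinner_A flip: AN)
    then show "cinner (W (A (A (V x)))) y = cinner (B x) y"
      by (simp add: B_def adj_U iso flip: VU)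
  qed
  \<comment> \<open>\<open>A (A (V x))\<close> and its projection \<open>V (B x)\<close> to the range of \<open>V\<close> have the same norm.\<close>
  have A2V: "A (A (V x)) = V (B x)" for x
  proof -
    \<comment> \<open>Two of the four factors \<open>A\<close> are traded for an \<open>N\<close> on
      each side, so that \<open>V (U x)\<close> appears and quasinormality of \<open>U\<close> can
      be applied.\<close>
    have "cinner (A (A (V x))) (A (A (V x))) = cinner (A (A (N (N (V x))))) (N (N (V x)))"
      by (metis A.selfadjoint AN cinner_A)
    also have "\<dots> = cinner (B (U x)) (U x)"
      by (simp add: WA2 flip: VU adj_V)
    also have "\<dots> = cinner (U (B x)) (U x)"
      by (simp only: UB)
    also have "\<dots> = cinner (B x) (B x)"
      by (simp only: B_def o_apply adj_U(2))
    finally have "(norm (A (A (V x))))\<^sup>2 = (norm (B x))\<^sup>2"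
      by (metis Re_cinner_self)
    moreover have "(norm (V (B x)))\<^sup>2 = (norm (B x))\<^sup>2"
      by (metis Re_cinner_self iso)
    moreover have "cinner (A (A (V x))) (V (B x)) = cinner (B x) (B x)"
      by (simp add: WA2 flip: adj_V)
    ultimately have "(norm (A (A (V x)) - V (B x)))\<^sup>2 = 0"
      by (simp add: norm_diff_cinner Re_cinner_self)
    then show ?thesis by simp
  qed
  \<comment> \<open>An invariant subspace of a self-adjoint operator is reducing.\<close>
  have A2P: "A (A (P x)) = P (A (A x))" for x
  proof (rule cinner_eqI)
    fix y
    have "cinner (A (A (P x))) y = cinner (W x) (B (W y))"
      by (simp add: P_def A2V B_sym flip: adj_V)
    also have "\<dots> = cinner x (A (A (V (W y))))"
      by (simp add: A2V adj_V)
    also have "\<dots> = cinner (P (A (A x))) y"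
      by (metis P_def o_apply A.selfadjoint adj_V)
    finally show "cinner (A (A (P x))) y = cinner (P (A (A x))) y" .
  qed
  have "bounded_linear P"
    using bounded_linear_compose[OF lin(1,3)] by (simp add: P_def o_def)
  then have "bounded_linear (\<lambda>x. P (A x) - A (P x))"
    using bounded_linear_compose A_bounded by (intro bounded_linear_sub) blast+
  \<comment> \<open>Anticommutation of PA - AP with \<open>A\<close> amounts to A^2 P = P A^2, which
    is \<open>A2P\<close>.\<close>
  then have "A (P (A x) - A (P x)) = 0" for x
    by (rule A.anticommute_imp_zero)
      (simp add: A.diff A2P)
  then have APA: "A (P (A x)) = A (A (P x))" for x
    by (simp add: A.diff)
  have P_V: "P (V x) = V x" for x
    by (simp add: P_def WV)
  have AV: "A (V x) = V (cadjoint T (T x))" for x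
  proof -
    \<comment> \<open>By \<open>APA\<close>, the operator \<open>A\<close> kills the component of
      \<open>A (V x)\<close> orthogonal to the range of \<open>V\<close>. This component is then
      orthogonal to \<open>A (V x)\<close> and to its projection, hence to itself.\<close>
    have "cinner (A (V x) - P (A (V x))) (A (V x)) = 0"
      using APA[of "V x"] by (simp add: P_V cinner_diff_left A.diff flip: A.selfadjoint)
    moreover have "cinner (A (V x) - P (A (V x))) (P (A (V x))) = 0"
      by (simp add: P_def W.diff WV flip: adj_V)
    ultimately have "Re (cinner (A (V x) - P (A (V x))) (A (V x) - P (A (V x)))) = 0"
      by (simp add: cinner_diff_right)
    then show ?thesis
      by (simp add: Re_cinner_self P_def WA)
  qed
  \<comment> \<open>Both sides are \<open>N (A (V x)) = A (N (V x))\<close>, read through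
    \<open>V\<close>.\<close>
  have "V (T (cadjoint T (T x))) = V (cadjoint T (T (T x)))" for x
    by (metis AN AV NV)
  then show ?thesis
    unfolding quasinormal_op_def o_def by (blast intro: V_inj)
qed

end
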